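(* Let $(X,p)$ be a complete TVS-cone metric space over a cone $P$ in a real Hausdorff locally convex topological vector space $E$, let $e\in\operatorname{int}P$, and let $T:X\to X$ be a mapping satisfying $p(Tx,Ty)\le\varphi(p(x,y))$ for all $x,y\in X$, where $\varphi:P\to P$ is increasing, upper semicontinuous from the right, and $\varphi(re)\ll re$ for every real number $r>0$. Then $T$ has a unique fixed point, say $u$, and $T^nx\to u$ as $n\to\infty$ for all $x\in X$.
   Context: A cone is a non-empty subset $P\subset E$ with $P+P\subset P$, $\lambda P\subset P$ for all $\lambda\ge 0$, and $P\cap(-P)=\{0\}$; $P$ is always assumed closed with nonempty interior $\operatorname{int}P$. Write $x\le y$ iff $y-x\in P$, and $x\ll y$ iff $y-x\in\operatorname{int}P$. A TVS-cone metric space (TVS-CMS) $(X,p)$ over $P$ is a non-empty set $X$ with a map $p:X\times X\to E$ such that for all $x,y,z\in X$: $0\le p(x,y)$; $p(x,y)=0$ iff $x=y$; $p(x,y)=p(y,x)$; $p(x,y)\le p(x,z)+p(z,y)$. A sequence $\{x_n\}$ in $X$ converges to $x$ if for every $c\gg 0$ there is $M$ with $p(x_n,x)\ll c$ for all $n\ge M$; it is Cauchy if for every $c\gg0$ there is $M$ with $p(x_n,x_m)\ll c$ for all $n,m\ge M$; $(X,p)$ is complete if every Cauchy sequence converges. "Increasing" means order-preserving ($u\le v$ implies $\varphi(u)\le\varphi(v)$). "Upper semicontinuous from the right" means: for every $u\in P$ and every $c\gg0$ there is a neighborhood $V$ of $u$ in $E$ such that $\varphi(v)\ll\varphi(u)+c$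 for all $v\in V\cap P$ with $u\le v$. *)

theory Defs
  imports "HOL-Analysis.Analysis"
begin

class topological_real_vector = real_vector + topological_ab_group_add +
  assumes tendsto_scaleR_Pair:
    "LIM z (nhds (r::real) \<times>\<^sub>F nhds x). fst z *\<^sub>R snd z :> nhds (r *\<^sub>R x)"

text \<open>The constant \<^const>\<open>convex\<close> is not available inside a class specification, so its definition
  is unfolded here; the lemma below restates the axiom.\<close>

class locally_convex_t2_space = topological_real_vector + t2_space +
  assumes locally_convex_raw:
    "open U \<Longrightarrow> 0 \<in> U \<Longrightarrow> \<exists>V. open V \<and> 0 \<in> V \<and>
       (\<forall>x\<in>V. \<forall>y\<in>V. \<forall>u\<ge>0. \<forall>v\<ge>0. u + v = 1 \<longrightarrow> u *\<^sub>R x + v *\<^sub>R y \<in> V) \<and> V \<subseteq> U"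

lemma locally_convex:
  fixes U :: "'a::locally_convex_t2_space set"
  assumes "open U" "0 \<in> U"
  shows "\<exists>V. open V \<and> 0 \<in> V \<and> convex V \<and> V \<subseteq> U"
  using locally_convex_raw[OF assms] unfolding convex_def .

text \<open>Cones are closed with nonempty interior by convention. The library's \<^const>\<open>cone\<close> only
  asks for closure under nonnegative scaling, so it is not used on its own.\<close>

definition tvs_cone :: "'e::topological_real_vector set \<Rightarrow> bool" where
  "tvs_cone P \<longleftrightarrow>
     P \<noteq> {} \<and>
     (\<forall>x\<in>P. \<forall>y\<in>P. x + y \<in> P) \<and>
     (\<forall>x\<in>P. \<forall>r\<ge>0. r *\<^sub>R x \<in> P) \<and>
     P \<inter> uminus ` P = {0} \<and>
     closed P \<and> interior P \<noteq> {}"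

definition cone_le :: "'e::topological_real_vector set \<Rightarrow> 'e \<Rightarrow> 'e \<Rightarrow> bool" where
  "cone_le P x y \<longleftrightarrow> y - x \<in> P"

definition cone_ll :: "'e::topological_real_vector set \<Rightarrow> 'e \<Rightarrow> 'e \<Rightarrow> bool" where
  "cone_ll P x y \<longleftrightarrow> y - x \<in> interior P"

definition tvs_cms ::
  "'e::topological_real_vector set \<Rightarrow> 'x set \<Rightarrow> ('x \<Rightarrow> 'x \<Rightarrow> 'e) \<Rightarrow> bool" where
  "tvs_cms P X p \<longleftrightarrow>
     tvs_cone P \<and> X \<noteq> {} \<and>
     (\<forall>x\<in>X. \<forall>y\<in>X. cone_le P 0 (p x y)) \<and>
     (\<forall>x\<in>X. \<forall>y\<in>X. p x y = 0 \<longleftrightarrow> x = y) \<and>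
     (\<forall>x\<in>X. \<forall>y\<in>X. p x y = p y x) \<and>
     (\<forall>x\<in>X. \<forall>y\<in>X. \<forall>z\<in>X. cone_le P (p x y) (p x z + p z y))"

definition cms_converges ::
  "'e::topological_real_vector set \<Rightarrow> ('x \<Rightarrow> 'x \<Rightarrow> 'e) \<Rightarrow> (nat \<Rightarrow> 'x) \<Rightarrow> 'x \<Rightarrow> bool" where
  "cms_converges P p s x \<longleftrightarrow>
     (\<forall>c. cone_ll P 0 c \<longrightarrow> (\<exists>M. \<forall>n\<ge>M. cone_ll P (p (s n) x) c))"

definition cms_Cauchy ::
  "'e::topological_real_vector set \<Rightarrow> ('x \<Rightarrow> 'x \<Rightarrow> 'e) \<Rightarrow> (nat \<Rightarrow> 'x) \<Rightarrow> bool" where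
  "cms_Cauchy P p s \<longleftrightarrow>
     (\<forall>c. cone_ll P 0 c \<longrightarrow> (\<exists>M. \<forall>n\<ge>M. \<forall>m\<ge>M. cone_ll P (p (s n) (s m)) c))"

definition complete_tvs_cms ::
  "'e::topological_real_vector set \<Rightarrow> 'x set \<Rightarrow> ('x \<Rightarrow> 'x \<Rightarrow> 'e) \<Rightarrow> bool" where
  "complete_tvs_cms P X p \<longleftrightarrow>
     tvs_cms P X p \<and>
     (\<forall>s. range s \<subseteq> X \<longrightarrow> cms_Cauchy P p s \<longrightarrow> (\<exists>x\<in>X. cms_converges P p s x))"

definition usc_from_right ::
  "'e::topological_real_vector set \<Rightarrow> ('e \<Rightarrow> 'e) \<Rightarrow> bool" where
  "usc_from_right P \<phi> \<longleftrightarrow>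
     (\<forall>u\<in>P. \<forall>c. cone_ll P 0 c \<longrightarrow>
       (\<exists>V. open V \<and> u \<in> V \<and>
         (\<forall>v\<in>V \<inter> P. cone_le P u v \<longrightarrow> cone_ll P (\<phi> v) (\<phi> u + c))))"

end

theory Submission
  imports Defs
begin

text \<open>
  Since \<open>e\<close> is an interior point of the closed cone, multiples of \<open>e\<close> measure the whole space: every
  vector lies below some \<open>r e\<close>, every \<open>c \<ggreater> 0\<close> lies above some \<open>r e\<close> with \<open>r > 0\<close>, and a vector
  of the cone below \<open>r e\<close> for all \<open>r > 0\<close> is zero. So \<open>p x y \<le> r e\<close> can be read as ``the distance
  of \<open>x\<close> and \<open>y\<close> is at most \<open>r\<close>'', and the theorem becomes a fixed point theorem of Boyd--Wong type
  with a real parameter.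

  In this reading the hypotheses on \<open>\<phi>\<close> combine to a strict gap: for each \<open>L > 0\<close> there is \<open>h > 0\<close>
  such that distances up to \<open>L + h\<close> are sent to distances at most \<open>L - h\<close>
  (lemma \<open>gap\<close>; semicontinuity gives room to the right of \<open>L\<close>, and \<open>\<phi> (L e) \<lless> L e\<close> gives room
  below). Hence the infimum of the bounds that hold somewhere along a sequence with
  \<open>a (n + 1) \<le> \<phi> (a n)\<close> cannot be positive, and such a sequence tends to \<open>0\<close>
  (lemma \<open>iterates_eventually_small\<close>).

  Applied to consecutive distances along an orbit this yields an index \<open>N\<close> at which the orbit moves
  so little that \<open>T\<close> maps the \<open>\<epsilon>\<close>-ball around \<open>T\<^sup>N x\<close> into itself. The orbit stays in this ball, so it
  is Cauchy, and its limit is fixed because \<open>T\<close> does not increase distances. Applied to the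
  distances between the orbit of \<open>x\<close> and a fixed point, the same lemma gives convergence of every
  orbit, and applied to the constant distance of two fixed points it gives uniqueness.
\<close>

section \<open>Interior points of a cone as units of measurement\<close>

lemma tendsto_scaleR_tvs:
  fixes b :: "'e::topological_real_vector"
  assumes "(f \<longlongrightarrow> (a::real)) F" "(g \<longlongrightarrow> b) F"
  shows "((\<lambda>x. f x *\<^sub>R g x) \<longlongrightarrow> a *\<^sub>R b) F"
  using filterlim_compose[OF tendsto_scaleR_Pair filterlim_Pair[OF assms]] by simp

text \<open>Continuity of scalar multiplication enters mainly in this form: open sets tolerate small moves
  in any direction. Every choice of a small multiple of \<open>e\<close> below rests on it.\<close>

lemma open_contains_ray:
  fixes x v :: "'e::topological_real_vector"
  assumes "open U" "x \<in> U"
  shows "\<exists>d>0. \<forall>t. 0 \<le> t \<longrightarrow> t \<le> d \<longrightarrow> x + t *\<^sub>R v \<in> U"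
proof -
  have "((\<lambda>t. x + t *\<^sub>R v) \<longlongrightarrow> x + 0 *\<^sub>R v) (nhds 0)"
    by (intro tendsto_add tendsto_const tendsto_scaleR_tvs filterlim_ident)
  then have "((\<lambda>t. x + t *\<^sub>R v) \<longlongrightarrow> x) (nhds 0)"
    by simp
  then have "eventually (\<lambda>t. x + t *\<^sub>R v \<in> U) (nhds 0)"
    using assms by (rule topological_tendstoD)
  then obtain d where "d > 0" "\<And>t. dist t 0 < d \<Longrightarrow> x + t *\<^sub>R v \<in> U"
    unfolding eventually_nhds_metric by auto
  then show ?thesis
    by (intro exI[of _ "d / 2"]) auto
qed

lemma cone_le_trans:
  assumes "tvs_cone P" "cone_le P x y" "cone_le P y z"
  shows "cone_le P x z"
proof -
  have "(z - y) + (y - x) \<in> P"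
    using assms unfolding tvs_cone_def cone_le_def by blast
  then show ?thesis
    by (simp add: cone_le_def)
qed

lemma cone_le_add:
  assumes "tvs_cone P" "cone_le P x y" "cone_le P x' y'"
  shows "cone_le P (x + x') (y + y')"
proof -
  have "(y - x) + (y' - x') \<in> P"
    using assms unfolding tvs_cone_def cone_le_def by blast
  then show ?thesis
    by (simp add: cone_le_def algebra_simps)
qed

lemma cone_le_scaleR_mono:
  assumes "tvs_cone P" "e \<in> P" "r \<le> s"
  shows "cone_le P (r *\<^sub>R e) (s *\<^sub>R e)"
proof -
  have "(s - r) *\<^sub>R e \<in> P"
    using assms unfolding tvs_cone_def by simp
  then show ?thesis
    by (simp add: cone_le_def algebra_simps)
qed

lemma cone_ll_imp_le: "cone_ll P x y \<Longrightarrow> cone_le P x y"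
  unfolding cone_ll_def cone_le_def using interior_subset by blast

lemma cone_le_ll_trans:
  fixes P :: "'e::topological_real_vector set"
  assumes "tvs_cone P" "cone_le P x y" "cone_ll P y z"
  shows "cone_ll P x z"
proof -
  let ?U = "(\<lambda>w. w - (y - x)) -` interior P"
  have "open ?U"
    by (intro open_vimage open_interior continuous_intros)
  moreover have "z - x \<in> ?U"
    using assms(3) by (simp add: cone_ll_def)
  moreover have "?U \<subseteq> P"
  proof
    fix w assume "w \<in> ?U"
    then have "w - (y - x) \<in> P"
      using interior_subset by blast
    then have "(w - (y - x)) + (y - x) \<in> P"
      using assms unfolding tvs_cone_def cone_le_def by blast
    then show "w \<in> P" by simp
  qed
  ultimately show ?thesis
    unfolding cone_ll_def by (rule interiorI)
qed

lemma scaleR_in_interior_cone: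
  fixes P :: "'e::topological_real_vector set"
  assumes "tvs_cone P" "e \<in> interior P" "r > 0"
  shows "r *\<^sub>R e \<in> interior P"
proof -
  let ?U = "(\<lambda>w. (1 / r) *\<^sub>R w) -` interior P"
  have "continuous_on UNIV (\<lambda>w::'e. (1 / r) *\<^sub>R w)"
    unfolding continuous_on_def by (intro ballI tendsto_scaleR_tvs tendsto_const tendsto_ident_at)
  then have "open ?U"
    by (intro open_vimage open_interior)
  moreover have "r *\<^sub>R e \<in> ?U"
    using assms by simp
  moreover have "?U \<subseteq> P"
  proof
    fix w assume "w \<in> ?U"
    then have "(1 / r) *\<^sub>R w \<in> P"
      using interior_subset by blast
    then have "r *\<^sub>R (1 / r) *\<^sub>R w \<in> P"
      using assms unfolding tvs_cone_def by (meson less_imp_le)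
    then show "w \<in> P" using assms by simp
  qed
  ultimately show ?thesis
    by (rule interiorI)
qed

lemma cone_ll_lower_unit:
  fixes P :: "'e::topological_real_vector set"
  assumes "cone_ll P x y"
  shows "\<exists>d>0. cone_ll P (x + d *\<^sub>R e) y"
proof -
  from open_contains_ray[of "interior P" "y - x" "- e"] assms
  obtain d where "d > 0" "(y - x) + d *\<^sub>R (- e) \<in> interior P"
    unfolding cone_ll_def by (meson open_interior order_refl less_imp_le)
  then show ?thesis
    unfolding cone_ll_def by (intro exI[of _ d]) (simp add: algebra_simps)
qed

lemma cone_le_multiple_of_interior:
  fixes P :: "'e::topological_real_vector set"
  assumes "tvs_cone P" "e \<in> interior P"
  shows "\<exists>r>0. cone_le P z (r *\<^sub>R e)"
proof -
  \<comment> \<open>A small multiple of \<open>z\<close> is below \<open>e\<close> because \<open>e\<close> is interior; rescale.\<close>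
  have "cone_ll P 0 e"
    using assms(2) by (simp add: cone_ll_def)
  from cone_ll_lower_unit[OF this, of z]
  obtain d where d: "d > 0" "e - d *\<^sub>R z \<in> interior P"
    by (auto simp: cone_ll_def)
  then have "(1 / d) *\<^sub>R (e - d *\<^sub>R z) \<in> P"
    using scaleR_in_interior_cone[OF assms(1) d(2), of "1 / d"] interior_subset by fastforce
  then show ?thesis
    using d(1) by (intro exI[of _ "1 / d"]) (simp add: cone_le_def algebra_simps)
qed

text \<open>The Archimedean property: it is here that closedness and pointedness of the cone are used.\<close>

lemma cone_eq_0_if_le_all_multiples:
  fixes P :: "'e::topological_real_vector set"
  assumes "tvs_cone P" "z \<in> P" and le: "\<And>r. r > 0 \<Longrightarrow> cone_le P z (r *\<^sub>R e)"
  shows "z = 0"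
proof -
  have "- z \<in> P"
  proof (rule ccontr)
    assume "- z \<notin> P"
    moreover have "open (- P)"
      using assms(1) by (simp add: tvs_cone_def open_Compl)
    ultimately obtain d where "d > 0" "- z + d *\<^sub>R e \<in> - P"
      using open_contains_ray[of "- P" "- z" e] by (meson ComplI order_refl less_imp_le)
    then show False
      using le[of d] by (simp add: cone_le_def)
  qed
  then have "z \<in> P \<inter> uminus ` P"
    using assms(2) by (auto intro: image_eqI[of _ _ "- z"])
  then show ?thesis
    using assms(1) by (auto simp: tvs_cone_def)
qed

section \<open>Comparison functions on a cone\<close>

locale cone_comparison =
  fixes P :: "'e::topological_real_vector set" and e :: 'e and \<phi> :: "'e \<Rightarrow> 'e"
  assumes cone: "tvs_cone P"
    and e_interior: "e \<in> interior P"
    and increasing: "monotone_on P (cone_le P) (cone_le P) \<phi>"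
    and usc: "usc_from_right P \<phi>"
    and below: "\<And>r::real. r > 0 \<Longrightarrow> cone_ll P (\<phi> (r *\<^sub>R e)) (r *\<^sub>R e)"
begin

lemma e_in_cone: "e \<in> P"
  using e_interior interior_subset by blast

lemma scaleR_e_in_cone: "r \<ge> 0 \<Longrightarrow> r *\<^sub>R e \<in> P"
  using cone e_in_cone by (simp add: tvs_cone_def)

lemma le_e_mono: "cone_le P z (r *\<^sub>R e) \<Longrightarrow> r \<le> s \<Longrightarrow> cone_le P z (s *\<^sub>R e)"
  using cone_le_trans[OF cone] cone_le_scaleR_mono[OF cone e_in_cone] by blast

lemma increasing_at_e:
  assumes "z \<in> P" "cone_le P z (r *\<^sub>R e)" "r \<ge> 0"
  shows "cone_le P (\<phi> z) (\<phi> (r *\<^sub>R e))"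
  using increasing assms scaleR_e_in_cone by (auto simp: monotone_on_def)

lemma nonexpansive:
  assumes "z \<in> P" "cone_le P z (r *\<^sub>R e)" "r > 0"
  shows "cone_le P (\<phi> z) (r *\<^sub>R e)"
  using increasing_at_e[OF assms(1,2)] cone_ll_imp_le[OF below[OF assms(3)]] assms(3)
    cone_le_trans[OF cone] by (meson less_imp_le)

text \<open>The strict inequality at \<open>L e\<close> leaves a margin \<open>d e\<close>. Upper semicontinuity with tolerance
  \<open>(d / 2) e\<close> spends half of it on moving the argument to the right of \<open>L e\<close>; the other half
  remains.\<close>

lemma gap:
  assumes "L > 0"
  shows "\<exists>h>0. cone_le P (\<phi> ((L + h) *\<^sub>R e)) ((L - h) *\<^sub>R e)"
proof -
  obtain d where d: "d > 0" "cone_ll P (\<phi> (L *\<^sub>R e) + d *\<^sub>R e) (L *\<^sub>R e)"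
    using cone_ll_lower_unit[OF below[OF assms]] by blast
  have "cone_ll P 0 ((d / 2) *\<^sub>R e)"
    using scaleR_in_interior_cone[OF cone e_interior, of "d / 2"] d(1) by (simp add: cone_ll_def)
  then obtain V where V: "open V" "L *\<^sub>R e \<in> V"
    and near: "\<And>v. v \<in> V \<inter> P \<Longrightarrow> cone_le P (L *\<^sub>R e) v \<Longrightarrow>
                 cone_ll P (\<phi> v) (\<phi> (L *\<^sub>R e) + (d / 2) *\<^sub>R e)"
    using usc scaleR_e_in_cone[of L] assms unfolding usc_from_right_def
    by (metis less_imp_le)
  obtain t where t: "t > 0" "\<And>s. 0 \<le> s \<Longrightarrow> s \<le> t \<Longrightarrow> L *\<^sub>R e + s *\<^sub>R e \<in> V"
    using open_contains_ray[OF V] by blast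
  define h where "h = min t (d / 2)"
  have h: "h > 0" "h \<le> t" "h \<le> d / 2"
    using t(1) d(1) by (auto simp: h_def)
  have "(L + h) *\<^sub>R e \<in> V \<inter> P"
    using t(2)[of h] h scaleR_e_in_cone[of "L + h"] assms by (simp add: scaleR_add_left)
  then have "cone_le P (\<phi> ((L + h) *\<^sub>R e)) (\<phi> (L *\<^sub>R e) + (d / 2) *\<^sub>R e)"
    using cone_le_scaleR_mono[OF cone e_in_cone, of L "L + h"] h(1)
    by (intro cone_ll_imp_le[OF near]) simp_all
  moreover have "cone_le P (\<phi> (L *\<^sub>R e) + (d / 2) *\<^sub>R e) ((L - d / 2) *\<^sub>R e)"
  proof -
    have "d *\<^sub>R e = (d / 2) *\<^sub>R e + (d / 2) *\<^sub>R e"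
      by (simp flip: scaleR_add_left)
    then show ?thesis
      using cone_ll_imp_le[OF d(2)] by (simp add: cone_le_def scaleR_diff_left algebra_simps)
  qed
  ultimately have "cone_le P (\<phi> ((L + h) *\<^sub>R e)) ((L - h) *\<^sub>R e)"
    using cone_le_trans[OF cone] le_e_mono h(3) by (meson diff_left_mono)
  then show ?thesis
    using h(1) by blast
qed

text \<open>Let \<open>L\<close> be the infimum of all \<open>r > 0\<close> such that some term is at most \<open>r e\<close>. If \<open>L > 0\<close>, some term
  is at most \<open>(L + h) e\<close> with \<open>h\<close> from the gap, and its successor is at most \<open>(L - h) e\<close>, which
  undercuts \<open>L\<close>. Once a term is small, nonexpansiveness keeps all later ones small.\<close>

lemma iterates_eventually_small:
  fixes a :: "nat \<Rightarrow> 'e"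
  assumes in_cone: "\<And>n. a n \<in> P"
    and step: "\<And>n. cone_le P (a (Suc n)) (\<phi> (a n))"
    and "\<epsilon> > 0"
  shows "\<exists>N. \<forall>n\<ge>N. cone_le P (a n) (\<epsilon> *\<^sub>R e)"
proof -
  define A where "A = {r. r > 0 \<and> (\<exists>n. cone_le P (a n) (r *\<^sub>R e))}"
  have "A \<noteq> {}"
    using cone_le_multiple_of_interior[OF cone e_interior, of "a 0"] by (auto simp: A_def)
  have bdd: "bdd_below A"
    by (auto simp: A_def intro!: bdd_belowI[of _ 0])
  have "\<not> Inf A > 0"
  proof
    assume "Inf A > 0"
    then obtain h where h: "h > 0" "cone_le P (\<phi> ((Inf A + h) *\<^sub>R e)) ((Inf A - h) *\<^sub>R e)"
      using gap by blast
    obtain r where "r \<in> A" "r < Inf A + h"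
      using cInf_lessD[OF \<open>A \<noteq> {}\<close>, of "Inf A + h"] h(1) by auto
    then obtain n where "cone_le P (a n) ((Inf A + h) *\<^sub>R e)"
      using le_e_mono[of _ r "Inf A + h"] by (auto simp: A_def)
    then have "cone_le P (\<phi> (a n)) (\<phi> ((Inf A + h) *\<^sub>R e))"
      using increasing_at_e in_cone \<open>Inf A > 0\<close> h(1) by simp
    then have next_le: "cone_le P (a (Suc n)) ((Inf A - h) *\<^sub>R e)"
      using step h(2) cone_le_trans[OF cone] by blast
    \<comment> \<open>\<open>Inf A - h\<close> need not be positive, so the positive half of \<open>Inf A\<close> serves as a second candidate.\<close>
    define s where "s = max (Inf A - h) (Inf A / 2)"
    have "s \<in> A"
      using le_e_mono[OF next_le, of s] \<open>Inf A > 0\<close> by (auto simp: A_def s_def)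
    then have "Inf A \<le> s"
      using bdd by (rule cInf_lower)
    then show False
      using h(1) \<open>Inf A > 0\<close> by (auto simp: s_def)
  qed
  then obtain r where "r \<in> A" "r < \<epsilon>"
    using cInf_lessD[OF \<open>A \<noteq> {}\<close>, of \<epsilon>] \<open>\<epsilon> > 0\<close> by auto
  then obtain N where N: "cone_le P (a N) (\<epsilon> *\<^sub>R e)"
    using le_e_mono[of _ r \<epsilon>] by (auto simp: A_def)
  have "cone_le P (a n) (\<epsilon> *\<^sub>R e)" if "n \<ge> N" for n
    using that
  proof (induction n rule: dec_induct)
    case base
    show ?case by (rule N)
  next
    case (step n)
    then show ?case
      using nonexpansive in_cone assms(2,3) cone_le_trans[OF cone] by blast
  qed
  then show ?thesis by blast
qed

lemma ex_multiple_ll: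
  assumes "cone_ll P 0 c"
  shows "\<exists>r>0. \<forall>z. cone_le P z (r *\<^sub>R e) \<longrightarrow> cone_ll P z c"
  using cone_ll_lower_unit[OF assms, of e] cone_le_ll_trans[OF cone] by auto

lemma cms_convergesI:
  assumes "\<And>\<epsilon>. \<epsilon> > 0 \<Longrightarrow> \<exists>N. \<forall>n\<ge>N. cone_le P (p (s n) x) (\<epsilon> *\<^sub>R e)"
  shows "cms_converges P p s x"
  unfolding cms_converges_def using assms ex_multiple_ll by meson

lemma cms_convergesD:
  assumes "cms_converges P p s x" "\<epsilon> > 0"
  shows "\<exists>N. \<forall>n\<ge>N. cone_le P (p (s n) x) (\<epsilon> *\<^sub>R e)"
proof -
  have "cone_ll P 0 (\<epsilon> *\<^sub>R e)"
    using scaleR_in_interior_cone[OF cone e_interior assms(2)] by (simp add: cone_ll_def)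
  then show ?thesis
    using assms(1) cone_ll_imp_le unfolding cms_converges_def by blast
qed

lemma cms_CauchyI:
  assumes "\<And>\<epsilon>. \<epsilon> > 0 \<Longrightarrow> \<exists>N. \<forall>n\<ge>N. \<forall>m\<ge>N. cone_le P (p (s n) (s m)) (\<epsilon> *\<^sub>R e)"
  shows "cms_Cauchy P p s"
  unfolding cms_Cauchy_def using assms ex_multiple_ll by meson

end

section \<open>Contractions of a cone metric space\<close>

locale cone_contraction = cone_comparison P e \<phi>
  for P :: "'e::topological_real_vector set" and e :: 'e and \<phi> :: "'e \<Rightarrow> 'e" +
  fixes X :: "'x set" and p :: "'x \<Rightarrow> 'x \<Rightarrow> 'e" and T :: "'x \<Rightarrow> 'x"
  assumes cms: "tvs_cms P X p"
    and T_in: "x \<in> X \<Longrightarrow> T x \<in> X"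
    and contraction: "x \<in> X \<Longrightarrow> y \<in> X \<Longrightarrow> cone_le P (p (T x) (T y)) (\<phi> (p x y))"
begin

lemma dist_in_cone: "x \<in> X \<Longrightarrow> y \<in> X \<Longrightarrow> p x y \<in> P"
  using cms by (simp add: tvs_cms_def cone_le_def)

lemma dist_eq_0: "x \<in> X \<Longrightarrow> y \<in> X \<Longrightarrow> p x y = 0 \<longleftrightarrow> x = y"
  using cms by (simp add: tvs_cms_def)

lemma dist_commute: "x \<in> X \<Longrightarrow> y \<in> X \<Longrightarrow> p x y = p y x"
  using cms unfolding tvs_cms_def by blast

lemma dist_triangle_le:
  assumes "x \<in> X" "y \<in> X" "z \<in> X" "cone_le P (p x z) (r *\<^sub>R e)" "cone_le P (p z y) (s *\<^sub>R e)"
  shows "cone_le P (p x y) ((r + s) *\<^sub>R e)"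
proof -
  have "cone_le P (p x y) (p x z + p z y)"
    using cms assms(1-3) unfolding tvs_cms_def by blast
  then show ?thesis
    using cone_le_add[OF cone assms(4,5)] cone_le_trans[OF cone] by (simp add: scaleR_add_left)
qed

lemma eq_if_dist_le_all:
  assumes "x \<in> X" "y \<in> X" "\<And>r. r > 0 \<Longrightarrow> cone_le P (p x y) (r *\<^sub>R e)"
  shows "x = y"
  using cone_eq_0_if_le_all_multiples[OF cone dist_in_cone[OF assms(1,2)] assms(3)]
    dist_eq_0[OF assms(1,2)] by blast

lemma T_dist_le:
  assumes "x \<in> X" "y \<in> X" "cone_le P (p x y) (r *\<^sub>R e)" "r > 0"
  shows "cone_le P (p (T x) (T y)) (r *\<^sub>R e)"
  using contraction nonexpansive dist_in_cone assms cone_le_trans[OF cone] by blast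

lemma iterate_in: "x \<in> X \<Longrightarrow> (T ^^ n) x \<in> X"
  by (induction n) (auto intro: T_in)

lemma orbits_approach:
  assumes "x \<in> X" "y \<in> X" "\<epsilon> > 0"
  shows "\<exists>N. \<forall>n\<ge>N. cone_le P (p ((T ^^ n) x) ((T ^^ n) y)) (\<epsilon> *\<^sub>R e)"
  using assms by (intro iterates_eventually_small) (auto intro: dist_in_cone contraction iterate_in)

lemma orbit_Cauchy:
  assumes "x \<in> X"
  shows "cms_Cauchy P p (\<lambda>n. (T ^^ n) x)"
proof (rule cms_CauchyI)
  fix \<epsilon> :: real
  assume "\<epsilon> > 0"
  \<comment> \<open>Half of \<open>\<epsilon>\<close> as radius, since two points of a ball are compared through its centre.\<close>
  define \<rho> where "\<rho> = \<epsilon> / 2"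
  have "\<rho> > 0"
    using \<open>\<epsilon> > 0\<close> by (simp add: \<rho>_def)
  obtain d where "d > 0" "cone_ll P (\<phi> (\<rho> *\<^sub>R e) + d *\<^sub>R e) (\<rho> *\<^sub>R e)"
    using cone_ll_lower_unit[OF below[OF \<open>\<rho> > 0\<close>]] by blast
  then have d: "d > 0" "cone_le P (\<phi> (\<rho> *\<^sub>R e)) ((\<rho> - d) *\<^sub>R e)"
    using cone_ll_imp_le[of P "\<phi> (\<rho> *\<^sub>R e) + d *\<^sub>R e"] by (auto simp: cone_le_def algebra_simps)
  obtain N where N: "cone_le P (p ((T ^^ N) x) ((T ^^ N) (T x))) (d *\<^sub>R e)"
    using orbits_approach[OF assms T_in[OF assms] d(1)] by blast
  define c where "c = (T ^^ N) x"
  have c: "c \<in> X" "cone_le P (p c (T c)) (d *\<^sub>R e)"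
    using N iterate_in[OF assms] by (simp_all add: c_def funpow_swap1)
  \<comment> \<open>The image of the ball of radius \<open>\<rho>\<close> about \<open>c\<close> lies within \<open>\<rho> - d\<close> of \<open>T c\<close>, which is within
    \<open>d\<close> of \<open>c\<close>.\<close>
  have ball: "cone_le P (p c (T y)) (\<rho> *\<^sub>R e)" if y: "y \<in> X" "cone_le P (p c y) (\<rho> *\<^sub>R e)" for y
  proof -
    have "cone_le P (\<phi> (p c y)) (\<phi> (\<rho> *\<^sub>R e))"
      using increasing_at_e dist_in_cone c(1) y \<open>\<rho> > 0\<close> by simp
    then have "cone_le P (p (T c) (T y)) ((\<rho> - d) *\<^sub>R e)"
      using contraction[OF c(1) y(1)] d(2) cone_le_trans[OF cone] by blast
    then show ?thesis
      using dist_triangle_le[OF c(1) T_in[OF y(1)] T_in[OF c(1)] c(2)] by fastforce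
  qed
  have close: "cone_le P (p c ((T ^^ n) x)) (\<rho> *\<^sub>R e)" if "n \<ge> N" for n
    using that
  proof (induction n rule: dec_induct)
    case base
    have "p c c = 0"
      using dist_eq_0 c(1) by blast
    then show ?case
      using scaleR_e_in_cone[of \<rho>] \<open>\<rho> > 0\<close> by (simp add: c_def cone_le_def)
  next
    case (step n)
    then show ?case
      using ball iterate_in[OF assms] by simp
  qed
  have "cone_le P (p ((T ^^ n) x) ((T ^^ m) x)) (\<epsilon> *\<^sub>R e)" if "n \<ge> N" "m \<ge> N" for n m
  proof -
    have "cone_le P (p ((T ^^ n) x) c) (\<rho> *\<^sub>R e)"
      using close[OF that(1)] dist_commute[OF c(1) iterate_in[OF assms]] by simp
    from dist_triangle_le[OF iterate_in[OF assms] iterate_in[OF assms] c(1) this close[OF that(2)]]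
    show ?thesis
      by (simp add: \<rho>_def)
  qed
  then show "\<exists>N. \<forall>n\<ge>N. \<forall>m\<ge>N. cone_le P (p ((T ^^ n) x) ((T ^^ m) x)) (\<epsilon> *\<^sub>R e)"
    by blast
qed

lemma limit_of_orbit_fixed:
  assumes "x \<in> X" "u \<in> X" "cms_converges P p (\<lambda>n. (T ^^ n) x) u"
  shows "T u = u"
proof (rule eq_if_dist_le_all[OF T_in[OF assms(2)] assms(2)])
  fix r :: real
  assume "r > 0"
  then obtain N where N: "\<And>n. n \<ge> N \<Longrightarrow> cone_le P (p ((T ^^ n) x) u) ((r / 2) *\<^sub>R e)"
    using cms_convergesD[OF assms(3), of "r / 2"] by auto
  have "cone_le P (p u ((T ^^ N) x)) ((r / 2) *\<^sub>R e)"
    using N[of N] dist_commute[OF assms(2) iterate_in[OF assms(1)]] by simp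
  then have "cone_le P (p (T u) ((T ^^ Suc N) x)) ((r / 2) *\<^sub>R e)"
    using T_dist_le[OF assms(2) iterate_in[OF assms(1)]] \<open>r > 0\<close> by simp
  from dist_triangle_le[OF T_in[OF assms(2)] assms(2) iterate_in[OF assms(1)] this N[of "Suc N"]]
  show "cone_le P (p (T u) u) (r *\<^sub>R e)"
    by simp
qed

lemma orbit_converges_to_fixed_point:
  assumes "u \<in> X" "T u = u" "x \<in> X"
  shows "cms_converges P p (\<lambda>n. (T ^^ n) x) u"
proof (rule cms_convergesI)
  have "(T ^^ n) u = u" for n
    using assms(2) by (induction n) auto
  then show "\<exists>N. \<forall>n\<ge>N. cone_le P (p ((T ^^ n) x) u) (\<epsilon> *\<^sub>R e)" if "\<epsilon> > 0" for \<epsilon>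
    using orbits_approach[OF assms(3,1) that] by simp
qed

lemma fixed_point_unique:
  assumes "u \<in> X" "T u = u" "v \<in> X" "T v = v"
  shows "v = u"
proof (rule eq_if_dist_le_all[OF assms(3,1)])
  have "(T ^^ n) v = v" for n
    using assms(4) by (induction n) auto
  then show "cone_le P (p v u) (r *\<^sub>R e)" if "r > 0" for r
    using cms_convergesD[OF orbit_converges_to_fixed_point[OF assms(1-3)] that] by auto
qed

end

theorem proposition34:
  fixes P :: "'e::locally_convex_t2_space set"
    and e :: 'e
    and X :: "'x set"
    and p :: "'x \<Rightarrow> 'x \<Rightarrow> 'e"
    and T :: "'x \<Rightarrow> 'x"
    and \<phi> :: "'e \<Rightarrow> 'e"
  assumes "complete_tvs_cms P X p"
    and "e \<in> interior P"
    and "T \<in> X \<rightarrow> X"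
    and "\<phi> \<in> P \<rightarrow> P"
    and "\<And>x y. x \<in> X \<Longrightarrow> y \<in> X \<Longrightarrow> cone_le P (p (T x) (T y)) (\<phi> (p x y))"
    and "monotone_on P (cone_le P) (cone_le P) \<phi>"
    and "usc_from_right P \<phi>"
    and "\<And>r::real. r > 0 \<Longrightarrow> cone_ll P (\<phi> (r *\<^sub>R e)) (r *\<^sub>R e)"
  shows "\<exists>u\<in>X. T u = u \<and> (\<forall>v\<in>X. T v = v \<longrightarrow> v = u) \<and>
           (\<forall>x\<in>X. cms_converges P p (\<lambda>n. (T ^^ n) x) u)"
proof -
  have cms: "tvs_cms P X p"
    and complete: "\<And>s. range s \<subseteq> X \<Longrightarrow> cms_Cauchy P p s \<Longrightarrow> \<exists>x\<in>X. cms_converges P p s x"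
    using assms(1) by (auto simp: complete_tvs_cms_def)
  interpret cone_contraction P e \<phi> X p T
    using cms assms by unfold_locales (auto simp: tvs_cms_def)
  obtain x where "x \<in> X"
    using cms by (auto simp: tvs_cms_def)
  then have "range (\<lambda>n. (T ^^ n) x) \<subseteq> X"
    using iterate_in by auto
  then obtain u where u: "u \<in> X" "cms_converges P p (\<lambda>n. (T ^^ n) x) u"
    using complete orbit_Cauchy[OF \<open>x \<in> X\<close>] by blast
  then have "T u = u"
    using limit_of_orbit_fixed \<open>x \<in> X\<close> by blast
  then show ?thesis
    using u(1) fixed_point_unique orbit_converges_to_fixed_point by blast
qed

end
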